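(* Let $x$ be a point in the interior of $C_N^A$, and let $y\in\mathbb R^N$. Let $k_0\ge 1/2$ be such that $\sqrt k\cdot x+y$ lies in the interior of $C_N^A$ for all $k\ge k_0$. For $k\ge k_0$ consider the Bessel processes $(X_{t,k})_{t\ge0}$ of type $A_{N-1}$ on $C_N^A$, started at $\sqrt k\cdot x+y$, which satisfy the SDEs \[ dX_{t,k}^i = dB_t^i+ k\sum_{j\ne i} \frac{1}{X_{t,k}^i-X_{t,k}^j}\,dt \qquad(i=1,\ldots,N).\] Then, for all $t>0$, \[\sup_{0\le s\le t,\; k\ge k_0}\|X_{s,k}-\sqrt k\, \phi(s,x) \|<\infty\quad\text{almost surely.}\] In particular, $X_{t,k}/\sqrt k\to \phi(t,x)$ for $k\to\infty$ locally uniformly in $t$ almost surely, and thus locally uniformly in $t$ in probability.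
   Context: $N$ is the number of particles, $C_N^A:=\{x\in \mathbb R^N: x_1\ge x_2\ge\ldots\ge x_N\}$, and $\|\cdot\|$ is the Euclidean norm. $(B_t)_{t\ge0}=(B_t^1,\ldots,B_t^N)_{t\ge0}$ is an $N$-dimensional Brownian motion started at $0$, and the same Brownian motion drives the SDEs for all $k\ge k_0$. For each $k$, the Bessel process $(X_{t,k})_{t\ge0}$ of type $A_{N-1}$ with multiplicity $k$ is the unique strong solution in $C_N^A$ of the displayed SDE with the given starting point. $\phi(t,x)$ denotes the solution at time $t\ge 0$ of the deterministic dynamical system $\frac{d}{dt}x(t)=H(x(t))$ in the interior of $C_N^A$ with $x(0)=x$, where \[H(x)=\Bigl( \sum_{j\ne1} \frac{1}{x_1-x_j},\ldots,\sum_{j\ne N} \frac{1}{x_N-x_j}\Bigr).\] This solution exists for all $t\ge0$ and stays in the interior of $C_N^A$. *)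

theory Defs
  imports "HOL-Probability.Probability"
begin

text \<open>
  Coordinates of \<open>\<real>\<^sup>N\<close> are indexed by an arbitrary finite linear order, which stands for
  \<open>1 < 2 < \<dots> < N\<close>.
\<close>

definition weyl_chamber_A :: "(real ^ 'n::{finite,linorder}) set" where
  "weyl_chamber_A = {x. \<forall>i j. i \<le> j \<longrightarrow> x $ j \<le> x $ i}"

definition H :: "real ^ 'n::{finite,linorder} \<Rightarrow> real ^ 'n::{finite,linorder}" where
  "H x = (\<chi> i. \<Sum>j\<in>UNIV - {i}. 1 / (x $ i - x $ j))"

definition H_trajectory :: "(real \<Rightarrow> real ^ 'n::{finite,linorder}) \<Rightarrow> real ^ 'n::{finite,linorder} \<Rightarrow> bool" where
  "H_trajectory u x \<longleftrightarrow>
     u 0 = x \<and>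
     (\<forall>t\<ge>0. u t \<in> interior weyl_chamber_A) \<and>
     (\<forall>t\<ge>0. (u has_vector_derivative H (u t)) (at t within {0..}))"

definition brownian_motion :: "'w measure \<Rightarrow> (real \<Rightarrow> 'w \<Rightarrow> real ^ 'n::finite) \<Rightarrow> bool" where
  "brownian_motion M B \<longleftrightarrow>
     prob_space M \<and>
     (\<forall>t\<ge>0. B t \<in> borel_measurable M) \<and>
     (AE \<omega> in M. B 0 \<omega> = 0) \<and>
     (AE \<omega> in M. continuous_on {0..} (\<lambda>t. B t \<omega>)) \<and>
     (\<forall>(\<tau>::nat \<Rightarrow> real) n. 0 \<le> \<tau> 0 \<and> mono \<tau> \<longrightarrow>
        prob_space.indep_vars M (\<lambda>_. borel) (\<lambda>m \<omega>. B (\<tau> (Suc m)) \<omega> - B (\<tau> m) \<omega>) {..<n}) \<and>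
     (\<forall>s t. 0 \<le> s \<and> s < t \<longrightarrow>
        prob_space.indep_vars M (\<lambda>_. borel) (\<lambda>i \<omega>. (B t \<omega> - B s \<omega>) $ i) UNIV \<and>
        (\<forall>i. distributed M lborel (\<lambda>\<omega>. (B t \<omega> - B s \<omega>) $ i) (normal_density 0 (sqrt (t - s)))))"

text \<open>The natural filtration, augmented by all subsets of null sets.\<close>

definition brownian_filtration ::
    "'w measure \<Rightarrow> (real \<Rightarrow> 'w \<Rightarrow> real ^ 'n::finite) \<Rightarrow> real \<Rightarrow> 'w measure" where
  "brownian_filtration M B t =
     sigma (space M)
       ({B s -` A \<inter> space M | s A. 0 \<le> s \<and> s \<le> t \<and> A \<in> sets borel} \<union> null_sets (completion M))"

text \<open>
  One path \<open>\<xi>\<close> of a solution of \<open>dX = dB + k H(X) dt\<close>, \<open>X\<^sub>0 = z\<close>, along the driving path \<open>b\<close>.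
  The noise is additive, so the SDE is an integral equation for each single path. Its drift has no
  meaning on the boundary of the chamber (where \<open>1 / 0 = 0\<close> would turn it into a finite value),
  hence the explicit requirement that the boundary is visited only at a null set of times.
\<close>

definition bessel_path ::
    "real \<Rightarrow> real ^ 'n::{finite,linorder} \<Rightarrow> (real \<Rightarrow> real ^ 'n::{finite,linorder})
       \<Rightarrow> (real \<Rightarrow> real ^ 'n::{finite,linorder}) \<Rightarrow> bool" where
  "bessel_path k z b \<xi> \<longleftrightarrow>
     continuous_on {0..} \<xi> \<and>
     (\<forall>t\<ge>0. \<xi> t \<in> weyl_chamber_A) \<and>
     (AE s in lborel. 0 \<le> s \<longrightarrow> \<xi> s \<in> interior weyl_chamber_A) \<and>
     (\<forall>t\<ge>0. set_integrable lborel {0..t} (\<lambda>s. k *\<^sub>R H (\<xi> s)) \<and>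
             \<xi> t = z + b t + (LINT s:{0..t}|lborel. k *\<^sub>R H (\<xi> s)))"

text \<open>
  Strong solutions \<open>X k\<close> for all \<open>k \<ge> k\<^sub>0\<close>, driven by the same Brownian motion, with starting points
  \<open>z k\<close>. The parameter \<open>k\<close> is uncountable and each \<open>X k\<close> is unique only up to a null set, so almost
  sure statements about all \<open>k\<close> at once depend on the choice of versions: one exceptional null set
  serves all \<open>k\<close>.
\<close>

definition bessel_processes_A ::
    "'w measure \<Rightarrow> (real \<Rightarrow> 'w \<Rightarrow> real ^ 'n::{finite,linorder}) \<Rightarrow> real \<Rightarrow> (real \<Rightarrow> real ^ 'n::{finite,linorder})
       \<Rightarrow> (real \<Rightarrow> real \<Rightarrow> 'w \<Rightarrow> real ^ 'n::{finite,linorder}) \<Rightarrow> bool" where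
  "bessel_processes_A M B k\<^sub>0 z X \<longleftrightarrow>
     (\<forall>k\<ge>k\<^sub>0. \<forall>t\<ge>0. X k t \<in> borel_measurable (brownian_filtration M B t)) \<and>
     (AE \<omega> in M. \<forall>k\<ge>k\<^sub>0. bessel_path k (z k) (\<lambda>t. B t \<omega>) (\<lambda>t. X k t \<omega>))"

text \<open>
  Processes with almost surely continuous paths: the suprema are then measurable only up to null
  sets, hence the completion.
\<close>

definition tendsto_locally_uniformly_in_prob ::
    "'w measure \<Rightarrow> (real \<Rightarrow> real \<Rightarrow> 'w \<Rightarrow> 'b::real_normed_vector) \<Rightarrow> (real \<Rightarrow> 'b) \<Rightarrow> bool" where
  "tendsto_locally_uniformly_in_prob M Y u \<longleftrightarrow>
     (\<forall>t>0. \<forall>\<epsilon>>0.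
        ((\<lambda>k. measure (completion M)
                {\<omega> \<in> space M. (SUP s\<in>{0..t}. ereal (norm (Y k s \<omega> - u s))) > ereal \<epsilon>})
           \<longlongrightarrow> 0) at_top)"

end

theory Submission
  imports Defs
begin

text \<open>
  The noise is additive, so everything is pathwise. Fix a continuous driving path \<open>b\<close> and put
  \<open>w = sqrt k \<phi>\<close>, which by homogeneity of \<open>H\<close> solves the same equation with \<open>b = 0\<close>. With
  \<open>G = k (H \<xi> - H w)\<close>, monotonicity of \<open>H\<close> gives
  \<open>G \<bullet> (\<xi> - w) \<le> - \<rho> |G| + C \<rho> (|\<xi> - w| + \<rho>)\<close>, where \<open>\<rho>\<close> and \<open>C\<close> do not depend on \<open>k\<close>, because
  the gaps of \<open>w\<close> are of order \<open>sqrt k\<close>. If \<open>\<beta>\<close> is a polynomial path with \<open>|b - \<beta>| \<le> \<rho>\<close>, then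
  \<open>D = \<xi> - w - (b - \<beta>)\<close> is absolutely continuous with derivative \<open>G + \<beta>'\<close>, and the term
  \<open>- \<rho> |G|\<close> absorbs \<open>G \<bullet> (b - \<beta>)\<close>. Gronwall's inequality for \<open>1 + |D|\<^sup>2\<close> bounds \<open>D\<close> uniformly in \<open>k\<close>.
\<close>

section \<open>Gaps between coordinates inside the Weyl chamber\<close>

text \<open>Raising coordinate \<open>j\<close> alone by \<open>e\<close> leads to a point of the
  ball, which is still in the chamber; so coordinate \<open>i\<close> had at least \<open>e\<close>
  to spare.\<close>

lemma cball_subset_weyl_chamber_A_gap:
  fixes x :: "real ^ 'n::{finite,linorder}"
  assumes e: "cball x e \<subseteq> weyl_chamber_A" "0 < e" and "i < j"
  shows "e \<le> x $ i - x $ j"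
proof -
  have "dist x (x + e *\<^sub>R axis j 1) = e"
    using e(2) by (simp add: dist_norm)
  then have "x + e *\<^sub>R axis j 1 \<in> weyl_chamber_A"
    using e by (auto intro: subsetD)
  then have "(x + e *\<^sub>R axis j 1) $ j \<le> (x + e *\<^sub>R axis j 1) $ i"
    using assms(3) unfolding weyl_chamber_A_def by (blast intro: less_imp_le)
  then show ?thesis
    using assms(3) by (simp add: axis_def split: if_splits)
qed

lemma interior_weyl_chamber_AD:
  assumes "x \<in> interior weyl_chamber_A" and "i < j"
  shows "x $ j < x $ i"
proof -
  obtain e where "e > 0" "cball x e \<subseteq> weyl_chamber_A"
    using assms(1) mem_interior_cball by blast
  then show ?thesis
    using cball_subset_weyl_chamber_A_gap[OF _ _ assms(2)] by fastforce
qed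

text \<open>A compact subset of an open set admits one ball radius for all of its points, and this
  radius controls all gaps. It is applied to the orbit of the flow over
  \<open>{0..T}\<close>.\<close>

lemma compact_interior_weyl_chamber_A_gap:
  assumes "compact K" and "K \<subseteq> interior weyl_chamber_A"
  obtains \<delta> where "\<delta> > 0" "\<And>x i j. x \<in> K \<Longrightarrow> i < j \<Longrightarrow> \<delta> \<le> x $ i - x $ j"
proof -
  obtain e where e: "e > 0" "(\<Union>x\<in>K. ball x e) \<subseteq> interior weyl_chamber_A"
    using compact_subset_open_imp_ball_epsilon_subset[OF assms(1) open_interior assms(2)] by blast
  \<comment> \<open>Halving the radius passes from open to closed balls.\<close>
  have "cball x (e / 2) \<subseteq> weyl_chamber_A" if "x \<in> K" for x
    using e that interior_subset[of weyl_chamber_A] by (fastforce simp: subset_iff)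
  then have "e / 2 \<le> x $ i - x $ j" if "x \<in> K" "i < j" for x i j
    using that e(1) by (intro cball_subset_weyl_chamber_A_gap) auto
  then show thesis
    using that[of "e / 2"] e(1) by simp
qed

section \<open>The drift \<open>H\<close>: homogeneity, monotonicity, local Lipschitz bound,
  coercivity\<close>

lemma H_scaleR: "H (c *\<^sub>R x) = inverse c *\<^sub>R H x"
proof -
  have "1 / (c * a - c * b) = inverse c * (1 / (a - b))" for a b :: real
    by (simp add: divide_inverse flip: right_diff_distrib)
  then show ?thesis
    by (simp add: H_def vec_eq_iff sum_distrib_left)
qed

text \<open>
  \<open>H\<close> is the gradient of the concave function \<open>\<Sum>ln (x\<^sub>i - x\<^sub>j)\<close>, summed over \<open>i < j\<close>. The proof
  symmetrizes the double sum, pairing the \<open>(i, j)\<close> and \<open>(j, i)\<close> terms.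
\<close>

lemma H_monotone:
  fixes u v :: "real ^ 'n::{finite,linorder}"
  assumes u: "\<And>i j. i < j \<Longrightarrow> u $ j < u $ i" and v: "\<And>i j. i < j \<Longrightarrow> v $ j < v $ i"
  shows "(H u - H v) \<bullet> (u - v) \<le> 0"
proof -
  define f where "f i j = 1 / (u $ i - u $ j) - 1 / (v $ i - v $ j)" for i j
  define w where "w = u - v"
  have f_swap: "f j i = - f i j" for i j
  proof -
    have "1 / (a - b) = - (1 / (b - a))" for a b :: real
      by (metis divide_minus_right minus_diff_eq)
    from this[of "u $ j"] this[of "v $ j"] show ?thesis
      by (simp add: f_def)
  qed
  have "(H u - H v) \<bullet> (u - v) = (\<Sum>i\<in>UNIV. \<Sum>j\<in>UNIV - {i}. f i j * w $ i)"
    by (simp add: inner_vec_def H_def f_def w_def sum_distrib_right flip: sum_subtractf)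
  \<comment> \<open>\<open>f i i\<close> is \<open>0\<close>, so the diagonal may be added and the
    two sums can be swapped.\<close>
  also have "\<dots> = (\<Sum>i\<in>UNIV. \<Sum>j\<in>UNIV. f i j * w $ i)"
    by (intro sum.cong sum.mono_neutral_left) (auto simp: f_def)
  finally have 1: "(H u - H v) \<bullet> (u - v) = (\<Sum>i\<in>UNIV. \<Sum>j\<in>UNIV. f i j * w $ i)" .
  also have "\<dots> = (\<Sum>j\<in>UNIV. \<Sum>i\<in>UNIV. f i j * w $ i)"
    by (rule sum.swap)
  also have "\<dots> = (\<Sum>i\<in>UNIV. \<Sum>j\<in>UNIV. - f i j * w $ j)"
    by (subst f_swap) simp
  finally have "2 * ((H u - H v) \<bullet> (u - v)) = (\<Sum>i\<in>UNIV. \<Sum>j\<in>UNIV. f i j * (w $ i - w $ j))"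
    unfolding mult_2 by (subst 1) (simp add: algebra_simps sum_subtractf sum_negf)
  also have "\<dots> \<le> 0"
  proof (intro sum_nonpos)
    fix i j :: 'n
    have "(1 / p - 1 / q) * (p - q) \<le> 0" if "p * q > 0" for p q :: real
    proof -
      have "(1 / p - 1 / q) * (p - q) = - ((p - q)\<^sup>2 / (p * q))"
        using that by (auto simp: field_simps power2_eq_square zero_less_mult_iff)
      then show ?thesis
        using that by simp
    qed
    note term_nonpos = this
    \<comment> \<open>The order of \<open>i\<close> and \<open>j\<close> prescribes the sign of both
      differences, so the signs agree.\<close>
    have "i \<noteq> j \<Longrightarrow> 0 < (u $ i - u $ j) * (v $ i - v $ j)"
      using u[of i j] u[of j i] v[of i j] v[of j i]
      by (cases i j rule: linorder_cases) (auto simp: zero_less_mult_iff)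
    moreover have "w $ i - w $ j = (u $ i - u $ j) - (v $ i - v $ j)"
      by (simp add: w_def)
    ultimately show "f i j * (w $ i - w $ j) \<le> 0"
      unfolding f_def using term_nonpos by (cases "i = j") simp_all
  qed
  finally show ?thesis by simp
qed

text \<open>Differences of coordinates change by at most \<open>2 * norm v \<le> d / 2\<close>, so
  they stay at least \<open>d / 2\<close> in absolute value, away from the pole of
  \<open>1 / p\<close>. For \<open>d\<close> of order \<open>sqrt k\<close> the constant is of order
  \<open>1 / k\<close>, which offsets the factor \<open>k\<close> of the drift.\<close>

lemma H_lipschitz:
  fixes w v :: "real ^ 'n::{finite,linorder}"
  assumes gap: "\<And>i j. i < j \<Longrightarrow> d \<le> w $ i - w $ j" and d: "0 < d" and v: "norm v \<le> d / 4"
  shows "norm (H (w + v) - H w) \<le> (4 * (real CARD('n))\<^sup>2 / d\<^sup>2) * norm v"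
proof -
  have term_le: "\<bar>1 / ((w + v) $ i - (w + v) $ j) - 1 / (w $ i - w $ j)\<bar> \<le> 4 / d\<^sup>2 * norm v"
    if "i \<noteq> j" for i j
  proof -
    define p where "p = w $ i - w $ j"
    define q where "q = v $ i - v $ j"
    have p: "\<bar>p\<bar> \<ge> d"
      using that gap[of i j] gap[of j i] d by (cases i j rule: linorder_cases) (auto simp: p_def)
    have q: "\<bar>q\<bar> \<le> 2 * norm v"
      using component_le_norm_cart[of v i] component_le_norm_cart[of v j] by (auto simp: q_def)
    have pq: "\<bar>p + q\<bar> \<ge> d / 2"
      using p q v by linarith
    have "p \<noteq> 0" "p + q \<noteq> 0"
      using p pq d by auto
    then have "1 / (p + q) - 1 / p = - q / ((p + q) * p)"
      by (simp add: diff_frac_eq mult.commute)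
    then have "\<bar>1 / (p + q) - 1 / p\<bar> = \<bar>q\<bar> / (\<bar>p + q\<bar> * \<bar>p\<bar>)"
      by (simp add: abs_mult)
    also have "\<dots> \<le> (2 * norm v) / (d / 2 * d)"
      using p q pq d by (intro frac_le mult_mono mult_pos_pos) auto
    also have "\<dots> = 4 / d\<^sup>2 * norm v"
      by (simp add: power2_eq_square)
    finally show ?thesis
      by (simp add: p_def q_def algebra_simps)
  qed
  have "norm (H (w + v) - H w) \<le> (\<Sum>i\<in>UNIV. \<bar>(H (w + v) - H w) $ i\<bar>)"
    by (rule norm_le_l1_cart)
  also have "\<dots> \<le> (\<Sum>i\<in>(UNIV::'n set). \<Sum>j\<in>(UNIV::'n set). 4 / d\<^sup>2 * norm v)"
  proof (rule sum_mono)
    fix i :: 'n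
    have "\<bar>(H (w + v) - H w) $ i\<bar>
        \<le> (\<Sum>j\<in>UNIV - {i}. \<bar>1 / ((w + v) $ i - (w + v) $ j) - 1 / (w $ i - w $ j)\<bar>)"
      by (simp add: H_def flip: sum_subtractf)
    also have "\<dots> \<le> (\<Sum>j\<in>UNIV - {i}. 4 / d\<^sup>2 * norm v)"
      by (intro sum_mono term_le) auto
    also have "\<dots> \<le> (\<Sum>j\<in>(UNIV::'n set). 4 / d\<^sup>2 * norm v)"
      by (rule sum_mono2) auto
    finally show "\<bar>(H (w + v) - H w) $ i\<bar> \<le> (\<Sum>j\<in>(UNIV::'n set). 4 / d\<^sup>2 * norm v)" .
  qed
  also have "\<dots> = (4 * (real CARD('n))\<^sup>2 / d\<^sup>2) * norm v"
    by (simp add: power2_eq_square)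
  finally show ?thesis .
qed

text \<open>
  Testing monotonicity at the point \<open>w - \<rho> sgn G\<close> near \<open>w\<close> instead of at \<open>w\<close> itself gains the term
  \<open>- \<rho> |G|\<close>, which absorbs the pairing of the singular drift with a perturbation of size \<open>\<rho>\<close>.
\<close>

lemma H_coercive:
  fixes u w :: "real ^ 'n::{finite,linorder}"
  assumes u: "\<And>i j. i < j \<Longrightarrow> u $ j < u $ i"
    and gap: "\<And>i j. i < j \<Longrightarrow> d \<le> w $ i - w $ j" and d: "0 < d"
    and \<rho>: "0 \<le> \<rho>" "\<rho> \<le> d / 4" and k: "0 \<le> k"
  defines "G \<equiv> k *\<^sub>R H u - k *\<^sub>R H w"
  shows "G \<bullet> (u - w) \<le> - \<rho> * norm G
    + k * (4 * (real CARD('n))\<^sup>2 / d\<^sup>2) * \<rho> * (norm (u - w) + \<rho>)"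
proof -
  define v where "v = - \<rho> *\<^sub>R sgn G"
  have nv: "norm v \<le> \<rho>"
    using \<rho> by (simp add: v_def norm_sgn)
  have Gv: "G \<bullet> v = - \<rho> * norm G"
    by (cases "G = 0")
      (auto simp: v_def sgn_div_norm power2_norm_eq_inner[symmetric] power2_eq_square)
  \<comment> \<open>\<open>K\<close> is the drift increment from \<open>w\<close> to
    \<open>w + v\<close>, so \<open>G - K\<close> is \<open>k\<close> times
    \<open>H u - H (w + v)\<close>. Monotonicity handles \<open>G - K\<close>, the Lipschitz bound
    handles \<open>K\<close>.\<close>
  define K where "K = k *\<^sub>R H (w + v) - k *\<^sub>R H w"
  have "norm (H (w + v) - H w) \<le> (4 * (real CARD('n))\<^sup>2 / d\<^sup>2) * norm v"
    using gap d nv \<rho> by (intro H_lipschitz) auto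
  also have "\<dots> \<le> (4 * (real CARD('n))\<^sup>2 / d\<^sup>2) * \<rho>"
    using nv by (intro mult_left_mono) auto
  finally have "norm K \<le> k * (4 * (real CARD('n))\<^sup>2 / d\<^sup>2 * \<rho>)"
    using k mult_left_mono[of _ _ k] unfolding K_def scaleR_diff_right[symmetric] norm_scaleR
    by (simp only: abs_of_nonneg)
  moreover have "norm (u - w - v) \<le> norm (u - w) + \<rho>"
    using norm_triangle_ineq4[of "u - w" v] nv by linarith
  ultimately have "norm K * norm (u - w - v)
      \<le> k * (4 * (real CARD('n))\<^sup>2 / d\<^sup>2 * \<rho>) * (norm (u - w) + \<rho>)"
    using k \<rho> by (intro mult_mono) auto
  then have K: "K \<bullet> (u - w - v) \<le> k * (4 * (real CARD('n))\<^sup>2 / d\<^sup>2) * \<rho> * (norm (u - w) + \<rho>)"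
    using norm_cauchy_schwarz[of K "u - w - v"] by (simp add: mult.assoc)
  \<comment> \<open>The bound \<open>\<rho> \<le> d / 4\<close> leaves gaps of at least
    \<open>d / 2\<close>.\<close>
  have "(w + v) $ j < (w + v) $ i" if "i < j" for i j
    using gap[OF that] component_le_norm_cart[of v i] component_le_norm_cart[of v j] nv \<rho> d
    by simp
  then have "(H u - H (w + v)) \<bullet> (u - (w + v)) \<le> 0"
    using u by (intro H_monotone) auto
  then have "k * ((H u - H (w + v)) \<bullet> (u - (w + v))) \<le> 0"
    using k by (simp add: mult_nonneg_nonpos)
  then have "(G - K) \<bullet> (u - w - v) \<le> 0"
    by (simp add: G_def K_def diff_diff_eq flip: scaleR_diff_right inner_scaleR_left)
  then have "G \<bullet> (u - w) \<le> G \<bullet> v + K \<bullet> (u - w - v)"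
    by (simp add: inner_diff_left inner_diff_right)
  then show ?thesis
    using Gv K by linarith
qed

section \<open>Gronwall's inequality and calculus for absolutely continuous paths\<close>

lemma gronwall_integral:
  fixes f :: "real \<Rightarrow> real"
  assumes f: "continuous_on {0..T} f" and L: "0 \<le> L" and T: "0 \<le> T"
    and le: "\<And>t. t \<in> {0..T} \<Longrightarrow> f t \<le> a + L * integral {0..t} f"
  shows "f T \<le> a * exp (L * T)"
proof -
  define I where "I t = integral {0..t} f" for t
  \<comment> \<open>The integrating factor \<open>exp (- (L * t))\<close> makes the right-hand side
    of the hypothesis nonincreasing.\<close>
  define u where "u t = (a + L * I t) * exp (- (L * t))" for t
  have I: "(I has_vector_derivative f t) (at t within {0..T})" if "t \<in> {0..T}" for t
    unfolding I_def using integral_has_vector_derivative[OF f that] .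
  then have "continuous_on {0..T} I"
    by (meson has_vector_derivative_continuous continuous_on_eq_continuous_within)
  then have cont: "continuous_on {0..T} u"
    unfolding u_def by (intro continuous_intros)
  have "u T \<le> u 0"
  proof (rule DERIV_nonpos_imp_decreasing_open[OF T _ cont])
    fix t assume t: "0 < t" "t < T"
    then have "(I has_real_derivative f t) (at t)"
      using I[of t] by (simp add: at_within_Icc_at has_real_derivative_iff_has_vector_derivative)
    then have "(u has_real_derivative
        (L * f t * exp (- (L * t)) + (a + L * I t) * (exp (- (L * t)) * - L))) (at t)"
      unfolding u_def by (auto intro!: derivative_eq_intros)
    moreover have "L * f t * exp (- (L * t)) + (a + L * I t) * (exp (- (L * t)) * - L)
        = - (L * exp (- (L * t)) * (a + L * I t - f t))"
      by (simp add: algebra_simps)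
    moreover have "L * exp (- (L * t)) * (a + L * I t - f t) \<ge> 0"
      using L le[of t] t by (intro mult_nonneg_nonneg) (auto simp: I_def)
    ultimately show "\<exists>y. (u has_real_derivative y) (at t) \<and> y \<le> 0"
      by (metis neg_le_0_iff_le)
  qed
  then have "(a + L * I T) * exp (- (L * T)) \<le> a"
    by (simp add: u_def I_def)
  then have "a + L * I T \<le> a * exp (L * T)"
    by (simp add: exp_minus field_simps)
  then show ?thesis
    using le[of T] T by (simp add: I_def)
qed

text \<open>A continuous factor on a compact interval is bounded and measurable, which preserves
  absolute integrability. The drift along a Bessel path is known only to be integrable.\<close>

lemma absolutely_integrable_inner_continuous:
  fixes g D :: "real \<Rightarrow> 'a::euclidean_space"
  assumes "g absolutely_integrable_on {a..b}" and "continuous_on {a..b} D"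
  shows "(\<lambda>s. g s \<bullet> D s) absolutely_integrable_on {a..b}"
proof -
  have "D \<in> borel_measurable (lebesgue_on {a..b})"
    using assms(2) by (rule continuous_imp_measurable_on_sets_lebesgue) auto
  moreover have "bounded (D ` {a..b})"
    using assms(2) compact_continuous_image compact_imp_bounded by blast
  moreover have "bilinear ((\<bullet>) :: 'a \<Rightarrow> 'a \<Rightarrow> real)"
    by (simp add: bilinear_conv_bounded_bilinear bounded_bilinear_inner)
  ultimately have "(\<lambda>s. D s \<bullet> g s) absolutely_integrable_on {a..b}"
    using assms(1)
    by (intro absolutely_integrable_bounded_measurable_product[where h = "(\<bullet>)"]) auto
  then show ?thesis
    by (simp add: inner_commute)
qed

text \<open>
  The chain rule for \<open>|D|\<^sup>2\<close> along an absolutely continuous path. Up to the error \<open>\<epsilon> \<integral>|g|\<close> it holds on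
  all intervals on which \<open>D\<close> oscillates by at most \<open>\<epsilon> / 2\<close>, because
  \<open>|D t|\<^sup>2 - |D s|\<^sup>2 = (D t - D s) \<bullet> (D t + D s)\<close>.
\<close>

lemma norm_power2_indefinite_integral_le:
  fixes g D :: "real \<Rightarrow> 'a::euclidean_space"
  assumes g: "g absolutely_integrable_on {0..T}" and T: "0 \<le> T"
    and D: "\<And>t. t \<in> {0..T} \<Longrightarrow> D t = d + integral {0..t} g"
  shows "(norm (D T))\<^sup>2 \<le> (norm d)\<^sup>2 + 2 * integral {0..T} (\<lambda>s. g s \<bullet> D s)"
proof -
  have gi: "g integrable_on {0..T}"
    using g by (simp add: absolutely_integrable_on_def)
  have "continuous_on {0..T} (\<lambda>t. d + integral {0..t} g)"
    by (intro continuous_intros indefinite_integral_continuous_1 gi)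
  then have contD: "continuous_on {0..T} D"
    using D by (metis (no_types, lifting) continuous_on_cong)
  define J where "J t = integral {0..t} (\<lambda>s. g s \<bullet> D s)" for t
  define A where "A t = integral {0..t} (\<lambda>s. norm (g s))" for t
  have gD: "(\<lambda>s. g s \<bullet> D s) integrable_on {0..T}"
    using absolutely_integrable_inner_continuous[OF g contD]
    by (simp add: absolutely_integrable_on_def)
  have ng: "(\<lambda>s. norm (g s)) integrable_on {0..T}"
    using g by (simp add: absolutely_integrable_on_def)
  have "(norm (D T))\<^sup>2 - 2 * J T \<le> (norm d)\<^sup>2 + e * A T" if e: "e > 0" for e
  proof -
    define F where "F t = (norm (D t))\<^sup>2 - 2 * J t - e * A t" for t
    have "uniformly_continuous_on {0..T} D"
      using contD by (intro compact_uniformly_continuous) auto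
    then obtain \<delta> where \<delta>: "\<delta> > 0"
      "\<And>s t. s \<in> {0..T} \<Longrightarrow> t \<in> {0..T} \<Longrightarrow> dist s t < \<delta> \<Longrightarrow> dist (D s) (D t) < e / 2"
      unfolding uniformly_continuous_on_def using e by (metis half_gt_zero)
    have step: "F t \<le> F s" if st: "0 \<le> s" "s \<le> t" "t \<le> T" "t - s < \<delta>" for s t
    proof -
      define c where "c = D t + D s"
      have split: "integral {0..t} h = integral {0..s} h + integral {s..t} h"
        if "h integrable_on {0..T}" for h :: "real \<Rightarrow> 'b::euclidean_space"
        using st integrable_subinterval_real[OF that, of 0 t]
        by (subst Henstock_Kurzweil_Integration.integral_combine) auto
      have sub: "h integrable_on {s..t}"
        if "h integrable_on {0..T}" for h :: "real \<Rightarrow> 'b::euclidean_space"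
        using st integrable_subinterval_real[OF that, of s t] by auto
      have gc: "(\<lambda>r. g r \<bullet> c) integrable_on {s..t}"
        using integrable_linear[OF sub[OF gi] bounded_linear_inner_left[of c]] by (simp add: o_def)
      have "D t - D s = integral {s..t} g"
        using D[of t] D[of s] split[OF gi] st by simp
      then have "(norm (D t))\<^sup>2 - (norm (D s))\<^sup>2 = integral {s..t} g \<bullet> c"
        by (simp add: c_def power2_norm_eq_inner inner_add_right inner_diff_left inner_diff_right inner_commute flip: \<open>D t - D s = integral {s..t} g\<close>)
      also have "\<dots> = integral {s..t} (\<lambda>r. g r \<bullet> c)"
        using integral_linear[OF sub[OF gi] bounded_linear_inner_left[of c]] by (simp add: o_def)
      also have "\<dots> \<le> integral {s..t} (\<lambda>r. 2 * (g r \<bullet> D r) + e * norm (g r))"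
      proof (rule integral_le[OF gc])
        show "(\<lambda>r. 2 * (g r \<bullet> D r) + e * norm (g r)) integrable_on {s..t}"
          by (intro integrable_add integrable_on_mult_right sub gD ng)
        fix r assume r: "r \<in> {s..t}"
        \<comment> \<open>\<open>D t\<close> and \<open>D s\<close> both lie within
          \<open>e / 2\<close> of \<open>D r\<close>, so replacing \<open>c\<close> by
          \<open>2 *\<^sub>R D r\<close> costs at most \<open>e * norm (g r)\<close>.\<close>
        have "norm (c - 2 *\<^sub>R D r) \<le> norm (D t - D r) + norm (D s - D r)"
          using norm_triangle_ineq[of "D t - D r" "D s - D r"] by (simp add: c_def scaleR_2 algebra_simps)
        also have "\<dots> \<le> e"
          using \<delta>(2)[of t r] \<delta>(2)[of s r] r st by (simp add: dist_norm)
        finally have "norm (g r) * norm (c - 2 *\<^sub>R D r) \<le> norm (g r) * e"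
          by (intro mult_left_mono) auto
        then show "g r \<bullet> c \<le> 2 * (g r \<bullet> D r) + e * norm (g r)"
          using norm_cauchy_schwarz[of "g r" "c - 2 *\<^sub>R D r"]
          by (simp add: inner_diff_right mult.commute)
      qed
      also have "\<dots> = 2 * integral {s..t} (\<lambda>r. g r \<bullet> D r) + e * integral {s..t} (\<lambda>r. norm (g r))"
        by (subst integral_add) (auto intro!: integrable_on_mult_right sub gD ng)
      finally show ?thesis
        using split[OF gD] split[OF ng] by (simp add: F_def J_def A_def algebra_simps)
    qed
    \<comment> \<open>Steps of length \<open>\<delta> / 2\<close> are strictly shorter than
      \<open>\<delta>\<close>; induction on their number extends the local estimate to
      \<open>{0..T}\<close>.\<close>
    have chain: "0 \<le> t \<Longrightarrow> t \<le> T \<Longrightarrow> t \<le> real n * (\<delta> / 2) \<Longrightarrow> F t \<le> F 0" for n t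
    proof (induction n arbitrary: t)
      case (Suc n)
      define s where "s = max 0 (t - \<delta> / 2)"
      have "F t \<le> F s"
        using Suc.prems \<delta>(1) by (intro step) (auto simp: s_def)
      also have "F s \<le> F 0"
        using Suc.prems \<delta>(1) by (intro Suc.IH) (auto simp: s_def max_def field_simps)
      finally show ?case .
    qed auto
    obtain n where "T / (\<delta> / 2) \<le> real n"
      using real_arch_simple by blast
    then have "F T \<le> F 0"
      using T \<delta>(1) by (intro chain[of T n]) (auto simp: field_simps)
    moreover have "D 0 = d"
      using D[of 0] T by simp
    ultimately show ?thesis
      by (simp add: F_def J_def A_def)
  qed
  note * = this
  have "(norm (D T))\<^sup>2 - 2 * J T \<le> (norm d)\<^sup>2"
  proof (rule field_le_epsilon)
    fix \<epsilon> :: real assume \<epsilon>: "\<epsilon> > 0"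
    have "A T \<ge> 0"
      unfolding A_def by (intro integral_nonneg ng) auto
    \<comment> \<open>The summand \<open>1\<close> keeps the choice of \<open>e\<close> meaningful
      when \<open>A T = 0\<close>.\<close>
    then have "\<epsilon> / (A T + 1) * A T \<le> \<epsilon>"
      using \<epsilon> by (simp add: field_simps)
    then show "(norm (D T))\<^sup>2 - 2 * J T \<le> (norm d)\<^sup>2 + \<epsilon>"
      using *[of "\<epsilon> / (A T + 1)"] \<epsilon> \<open>A T \<ge> 0\<close> by simp
  qed
  then show ?thesis
    by (simp add: J_def)
qed

section \<open>Integral equations for the Bessel path and the rescaled flow\<close>

text \<open>Translates the Lebesgue integral over \<open>lborel\<close> into the gauge integral on
  an interval, the form used by the chain rule and the fundamental theorem of calculus.\<close>

lemma bessel_path_integral: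
  fixes \<xi> :: "real \<Rightarrow> real ^ 'n::{finite,linorder}"
  assumes "bessel_path k z b \<xi>" and "0 \<le> t"
  shows "(\<lambda>s. k *\<^sub>R H (\<xi> s)) absolutely_integrable_on {0..t}"
    and "\<xi> t = z + b t + integral {0..t} (\<lambda>s. k *\<^sub>R H (\<xi> s))"
proof -
  have i: "set_integrable lborel {0..t} (\<lambda>s. k *\<^sub>R H (\<xi> s))"
    and eq: "\<xi> t = z + b t + (LINT s:{0..t}|lborel. k *\<^sub>R H (\<xi> s))"
    using assms by (auto simp: bessel_path_def)
  from i show "(\<lambda>s. k *\<^sub>R H (\<xi> s)) absolutely_integrable_on {0..t}"
    unfolding set_integrable_def
    by (subst integrable_completion) (auto dest: borel_measurable_integrable)
  from eq show "\<xi> t = z + b t + integral {0..t} (\<lambda>s. k *\<^sub>R H (\<xi> s))"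
    using set_borel_integral_eq_integral(2)[OF i] by simp
qed

text \<open>By homogeneity \<open>k *\<^sub>R H (sqrt k *\<^sub>R u s)\<close> equals
  \<open>sqrt k *\<^sub>R H (u s)\<close>. The result has the form of
  \<open>bessel_path_integral\<close> without noise, ready to be subtracted.\<close>

lemma H_trajectory_integral:
  fixes u :: "real \<Rightarrow> real ^ 'n::{finite,linorder}"
  assumes u: "H_trajectory u x" and t: "0 \<le> t" and k: "0 < k"
  shows "(\<lambda>s. k *\<^sub>R H (sqrt k *\<^sub>R u s)) absolutely_integrable_on {0..t}"
    and "sqrt k *\<^sub>R u t = sqrt k *\<^sub>R x + integral {0..t} (\<lambda>s. k *\<^sub>R H (sqrt k *\<^sub>R u s))"
proof -
  have eq: "k *\<^sub>R H (sqrt k *\<^sub>R u s) = sqrt k *\<^sub>R H (u s)" for s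
    using real_div_sqrt[of k] k by (simp add: H_scaleR divide_inverse)
  have deriv: "(u has_vector_derivative H (u s)) (at s within {0..t})" if "s \<in> {0..t}" for s
    by (rule has_vector_derivative_within_subset[of _ _ _ "{0..}"])
      (use u that in \<open>auto simp: H_trajectory_def\<close>)
  have contu: "continuous_on {0..t} u"
    using deriv by (meson has_vector_derivative_continuous continuous_on_eq_continuous_within)
  have neq: "u s $ i \<noteq> u s $ j" if "s \<in> {0..t}" "i \<noteq> j" for s i j
    using interior_weyl_chamber_AD[of "u s" i j] interior_weyl_chamber_AD[of "u s" j i] u that
    by (cases i j rule: linorder_cases) (auto simp: H_trajectory_def)
  have "continuous_on {0..t} (\<lambda>s. H (u s))"
    unfolding H_def using neq by (intro continuous_intros contu) auto
  then show "(\<lambda>s. k *\<^sub>R H (sqrt k *\<^sub>R u s)) absolutely_integrable_on {0..t}"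
    unfolding eq by (intro absolutely_integrable_continuous_real continuous_intros)
  have "((\<lambda>s. sqrt k *\<^sub>R H (u s)) has_integral (sqrt k *\<^sub>R (u t - u 0))) {0..t}"
    by (intro has_integral_cmul fundamental_theorem_of_calculus deriv t)
  then show "sqrt k *\<^sub>R u t = sqrt k *\<^sub>R x + integral {0..t} (\<lambda>s. k *\<^sub>R H (sqrt k *\<^sub>R u s))"
    using u unfolding eq
    by (simp add: integral_unique H_trajectory_def scaleR_diff_right del: integral_cmul)
qed

section \<open>The pathwise bound, uniform in \<open>k\<close>\<close>

text \<open>The order of quantifiers is the point: \<open>R\<close> is built from \<open>b\<close>,
  \<open>u\<close>, \<open>y\<close>, \<open>T\<close> and \<open>k\<^sub>0\<close> before
  \<open>k\<close> and \<open>\<xi>\<close> appear, so it serves all multiplicities and all solution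
  paths at once.\<close>

lemma bessel_path_deviation_bounded:
  fixes b u :: "real \<Rightarrow> real ^ 'n::{finite,linorder}"
  assumes b: "continuous_on {0..T} b" and u: "H_trajectory u x" and k0: "0 < k\<^sub>0"
  obtains R where "\<And>k \<xi> s. k\<^sub>0 \<le> k \<Longrightarrow> bessel_path k (sqrt k *\<^sub>R x + y) b \<xi> \<Longrightarrow> s \<in> {0..T}
    \<Longrightarrow> norm (\<xi> s - sqrt k *\<^sub>R u s) \<le> R"
proof -
  have "continuous_on {0..} u"
    using u unfolding H_trajectory_def continuous_on_eq_continuous_within
    by (auto intro: has_vector_derivative_continuous)
  then have "continuous_on {0..T} u"
    by (rule continuous_on_subset) auto
  then have "compact (u ` {0..T})"
    by (intro compact_continuous_image) auto
  moreover have "u ` {0..T} \<subseteq> interior weyl_chamber_A"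
    using u by (auto simp: H_trajectory_def)
  ultimately obtain \<delta> where \<delta>: "\<delta> > 0"
    "\<And>z i j. z \<in> u ` {0..T} \<Longrightarrow> i < j \<Longrightarrow> \<delta> \<le> z $ i - z $ j"
    by (rule compact_interior_weyl_chamber_A_gap) blast
  \<comment> \<open>\<open>k\<close> times the Lipschitz constant of \<open>H\<close> for the gap
    \<open>sqrt k * \<delta>\<close>; the factor \<open>k\<close> cancels.\<close>
  define c where "c = 4 * (real CARD('n))\<^sup>2 / \<delta>\<^sup>2"
  \<comment> \<open>A quarter of \<open>sqrt k\<^sub>0 * \<delta>\<close>, hence admissible in
    \<open>H_coercive\<close> for the gap \<open>sqrt k * \<delta>\<close> of every
    \<open>k \<ge> k\<^sub>0\<close>.\<close>
  define \<rho> where "\<rho> = \<delta> * sqrt k\<^sub>0 / 4"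
  have c: "0 \<le> c" and \<rho>: "0 < \<rho>"
    using \<delta>(1) k0 by (auto simp: c_def \<rho>_def)
  \<comment> \<open>The path \<open>b\<close> is merely continuous; its polynomial approximation has
    a derivative that is bounded on \<open>{0..T}\<close>.\<close>
  obtain \<beta> where \<beta>: "polynomial_function \<beta>" "\<And>s. s \<in> {0..T} \<Longrightarrow> norm (b s - \<beta> s) < \<rho>"
    using Stone_Weierstrass_polynomial_function[OF _ b \<rho>] by auto
  obtain \<beta>' where \<beta>': "polynomial_function \<beta>'"
    "\<And>s. (\<beta> has_vector_derivative \<beta>' s) (at s)"
    using has_vector_derivative_polynomial_function[OF \<beta>(1)] by blast
  have cont\<beta>': "continuous_on S \<beta>'" for S
    using \<beta>'(1) by (rule continuous_on_polymonial_function)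
  then have "bounded (\<beta>' ` {0..T})"
    by (intro compact_imp_bounded compact_continuous_image) auto
  then obtain m where m: "m > 0" "\<And>s. s \<in> {0..T} \<Longrightarrow> norm (\<beta>' s) \<le> m"
    unfolding bounded_pos by auto
  \<comment> \<open>\<open>L\<close> collects the coefficients that arise in \<open>drift\<close>
    below once every term is bounded by a multiple of
    \<open>1 + (norm (D s))\<^sup>2\<close>.\<close>
  define L where "L = c * \<rho> + m + 4 * c * \<rho>\<^sup>2"
  have L: "0 \<le> L"
    using c \<rho> m by (simp add: L_def)
  \<comment> \<open>This is the value of \<open>D\<close> at time \<open>0\<close>:
    \<open>sqrt k *\<^sub>R x\<close> and \<open>b 0\<close> cancel, so it does not depend on
    \<open>k\<close>.\<close>
  define d where "d = y + \<beta> 0"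
  \<comment> \<open>The Gronwall bound for \<open>norm (D t)\<close>, plus \<open>\<rho>\<close> for
    the difference of \<open>b\<close> and \<open>\<beta>\<close>.\<close>
  define R where "R = sqrt ((1 + (norm d)\<^sup>2) * exp (L * T)) + \<rho>"
  show thesis
  proof (rule that[of R])
    fix k \<xi> t
    assume k: "k\<^sub>0 \<le> k" and \<xi>: "bessel_path k (sqrt k *\<^sub>R x + y) b \<xi>" and t: "t \<in> {0..T}"
    define w where "w s = sqrt k *\<^sub>R u s" for s
    define G where "G s = k *\<^sub>R H (\<xi> s) - k *\<^sub>R H (w s)" for s
    define g where "g s = G s + \<beta>' s" for s
    define D where "D s = \<xi> s - w s - (b s - \<beta> s)" for s
    have kpos: "0 < k"
      using k k0 by simp
    have g: "g absolutely_integrable_on {0..s}" if "0 \<le> s" for s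
      unfolding g_def G_def w_def using that kpos
      by (intro set_integral_add set_integral_diff bessel_path_integral(1)[OF \<xi>]
          H_trajectory_integral(1)[OF u] absolutely_integrable_continuous_real cont\<beta>')
    \<comment> \<open>Subtracting the two integral equations and \<open>b - \<beta>\<close> removes
      the rough path \<open>b\<close>; only the smooth \<open>\<beta>\<close> remains.\<close>
    have D_eq: "D s = d + integral {0..s} g" if "0 \<le> s" for s
    proof -
      have "(\<beta>' has_integral (\<beta> s - \<beta> 0)) {0..s}"
        using that \<beta>'(2)
        by (intro fundamental_theorem_of_calculus) (auto intro: has_vector_derivative_at_within)
      moreover have "(\<lambda>s. k *\<^sub>R H (\<xi> s)) integrable_on {0..s}"
        "(\<lambda>s. k *\<^sub>R H (w s)) integrable_on {0..s}"
        using bessel_path_integral(1)[OF \<xi> that] H_trajectory_integral(1)[OF u that kpos]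
        by (simp_all add: absolutely_integrable_on_def w_def)
      ultimately have "integral {0..s} g = integral {0..s} (\<lambda>s. k *\<^sub>R H (\<xi> s))
          - integral {0..s} (\<lambda>s. k *\<^sub>R H (w s)) + (\<beta> s - \<beta> 0)"
        unfolding g_def G_def
        by (intro integral_unique has_integral_add has_integral_diff integrable_integral)
      moreover note bessel_path_integral(2)[OF \<xi> that] H_trajectory_integral(2)[OF u that kpos]
      ultimately show ?thesis
        by (simp add: D_def d_def w_def)
    qed
    have contD: "continuous_on {0..s} D" if "0 \<le> s" for s
    proof -
      have "continuous_on {0..s} (\<lambda>r. d + integral {0..r} g)"
        using g[OF that] by (intro continuous_intros indefinite_integral_continuous_1)
          (auto simp: absolutely_integrable_on_def)
      then show ?thesis
        using D_eq by (metis (no_types, lifting) atLeastAtMost_iff continuous_on_cong)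
    qed
    have drift: "2 * (g s \<bullet> D s) \<le> L * (1 + (norm (D s))\<^sup>2)"
      if s: "s \<in> {0..T}" and int: "\<xi> s \<in> interior weyl_chamber_A" for s
    proof -
      have sqk: "sqrt k\<^sub>0 \<le> sqrt k"
        using k by simp
      have gap: "sqrt k * \<delta> \<le> w s $ i - w s $ j" if "i < j" for i j
        using \<delta>(2)[of "u s" i j] s that kpos by (simp add: w_def flip: right_diff_distrib)
      have "G s \<bullet> (\<xi> s - w s) \<le> - \<rho> * norm (G s)
          + k * (4 * (real CARD('n))\<^sup>2 / (sqrt k * \<delta>)\<^sup>2) * \<rho> * (norm (\<xi> s - w s) + \<rho>)"
        unfolding G_def
        using gap interior_weyl_chamber_AD[OF int] kpos \<delta>(1) \<rho> mult_right_mono[OF sqk, of \<delta>]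
        by (intro H_coercive) (auto simp: \<rho>_def mult.commute)
      also have "k * (4 * (real CARD('n))\<^sup>2 / (sqrt k * \<delta>)\<^sup>2) = c"
        using kpos by (simp add: c_def power_mult_distrib)
      finally have 1: "G s \<bullet> (\<xi> s - w s) \<le> - \<rho> * norm (G s) + c * \<rho> * (norm (\<xi> s - w s) + \<rho>)" .
      have "norm (\<xi> s - w s) \<le> norm (D s) + \<rho>"
        using norm_triangle_ineq[of "D s" "b s - \<beta> s"] \<beta>(2)[OF s] by (simp add: D_def)
      then have 2: "c * \<rho> * (norm (\<xi> s - w s) + \<rho>) \<le> c * \<rho> * (norm (D s) + 2 * \<rho>)"
        using c \<rho> by (intro mult_left_mono) auto
      have "- (G s \<bullet> (b s - \<beta> s)) \<le> norm (G s) * norm (b s - \<beta> s)"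
        using norm_cauchy_schwarz[of "G s" "- (b s - \<beta> s)"] by (simp add: inner_diff_right norm_minus_commute)
      also have "\<dots> \<le> norm (G s) * \<rho>"
        using \<beta>(2)[OF s] by (intro mult_left_mono) auto
      finally have 3: "- (G s \<bullet> (b s - \<beta> s)) \<le> norm (G s) * \<rho>" .
      have "\<beta>' s \<bullet> D s \<le> norm (\<beta>' s) * norm (D s)"
        by (rule norm_cauchy_schwarz)
      also have "\<dots> \<le> m * norm (D s)"
        using m(2)[OF s] by (intro mult_right_mono) auto
      finally have 4: "\<beta>' s \<bullet> D s \<le> m * norm (D s)" .
      have "g s \<bullet> D s = G s \<bullet> (\<xi> s - w s) - G s \<bullet> (b s - \<beta> s) + \<beta>' s \<bullet> D s"
        by (simp add: g_def inner_add_left D_def inner_diff_right)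
      \<comment> \<open>The term \<open>norm (G s) * \<rho>\<close> lost in \<open>3\<close> is
        exactly what \<open>1\<close> gains, so the singular drift disappears from the
        estimate.\<close>
      then have "g s \<bullet> D s \<le> c * \<rho> * (norm (D s) + 2 * \<rho>) + m * norm (D s)"
        using 1 2 3 4 by (simp add: mult.commute)
      then have "2 * (g s \<bullet> D s) \<le> (c * \<rho> + m) * (2 * norm (D s)) + 4 * c * \<rho>\<^sup>2"
        by (simp add: algebra_simps power2_eq_square)
      also have "\<dots> \<le> (c * \<rho> + m) * (1 + (norm (D s))\<^sup>2) + 4 * c * \<rho>\<^sup>2 * (1 + (norm (D s))\<^sup>2)"
      proof (intro add_mono mult_left_mono)
        show "2 * norm (D s) \<le> 1 + (norm (D s))\<^sup>2"
          using zero_le_power2[of "norm (D s) - 1"] by (simp add: power2_diff)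
        show "4 * c * \<rho>\<^sup>2 \<le> 4 * c * \<rho>\<^sup>2 * (1 + (norm (D s))\<^sup>2)"
          using c \<rho> by (simp add: algebra_simps)
      qed (use c \<rho> m in auto)
      also have "\<dots> = L * (1 + (norm (D s))\<^sup>2)"
        by (simp add: L_def algebra_simps)
      finally show ?thesis .
    qed
    have "1 + (norm (D s))\<^sup>2 \<le> (1 + (norm d)\<^sup>2) + L * integral {0..s} (\<lambda>r. 1 + (norm (D r))\<^sup>2)"
      if s: "s \<in> {0..t}" for s
    proof -
      have s0: "0 \<le> s" "s \<le> T"
        using s t by auto
      have i1: "(\<lambda>r. 2 * (g r \<bullet> D r)) absolutely_integrable_on {0..s}"
        using s0 by (intro set_integrable_mult_right absolutely_integrable_inner_continuous g contD)
      have i2: "(\<lambda>r. L * (1 + (norm (D r))\<^sup>2)) absolutely_integrable_on {0..s}"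
        using s0 by (intro absolutely_integrable_continuous_real continuous_intros contD)
      \<comment> \<open>The estimate \<open>drift\<close> is available only at interior times; the
        boundary times form a null set, so it can still be integrated.\<close>
      have "AE r in lborel. 0 \<le> r \<longrightarrow> \<xi> r \<in> interior weyl_chamber_A"
        using \<xi> unfolding bessel_path_def by blast
      then have "AE r in lebesgue. r \<in> {0..s} \<longrightarrow> 2 * (g r \<bullet> D r) \<le> L * (1 + (norm (D r))\<^sup>2)"
        by (intro AE_completion) (use drift s0 in auto)
      then have "integral {0..s} (\<lambda>r. 2 * (g r \<bullet> D r))
          \<le> integral {0..s} (\<lambda>r. L * (1 + (norm (D r))\<^sup>2))"
        using set_integral_mono_AE[OF i1 i2]
        unfolding set_lebesgue_integral_eq_integral(2)[OF i1]
          set_lebesgue_integral_eq_integral(2)[OF i2] by blast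
      moreover have "(norm (D s))\<^sup>2 \<le> (norm d)\<^sup>2 + 2 * integral {0..s} (\<lambda>r. g r \<bullet> D r)"
        using s0 g D_eq by (intro norm_power2_indefinite_integral_le) auto
      ultimately show ?thesis
        by simp
    qed
    moreover have "continuous_on {0..t} (\<lambda>r. 1 + (norm (D r))\<^sup>2)"
      using t by (intro continuous_intros contD) auto
    ultimately have "1 + (norm (D t))\<^sup>2 \<le> (1 + (norm d)\<^sup>2) * exp (L * t)"
      using gronwall_integral[of t "\<lambda>r. 1 + (norm (D r))\<^sup>2" L "1 + (norm d)\<^sup>2"] L t by auto
    also have "\<dots> \<le> (1 + (norm d)\<^sup>2) * exp (L * T)"
      using L t by (intro mult_left_mono) (auto intro: mult_left_mono)
    finally have "norm (D t) \<le> sqrt ((1 + (norm d)\<^sup>2) * exp (L * T))"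
      by (intro real_le_rsqrt) simp
    then show "norm (\<xi> t - sqrt k *\<^sub>R u t) \<le> R"
      using norm_triangle_ineq[of "D t" "b t - \<beta> t"] \<beta>(2)[OF t]
      by (simp add: D_def R_def w_def)
  qed
qed

section \<open>From pathwise bounds to uniform limits, almost surely and in probability\<close>

text \<open>
  The exceedance events need not be measurable for this: the measure of a non-measurable set is \<open>0\<close>.
\<close>

lemma AE_uniform_limit_imp_tendsto_locally_uniformly_in_prob:
  assumes "prob_space M" and AE: "\<And>t. 0 < t \<Longrightarrow> AE \<omega> in M. uniform_limit {0..t} (\<lambda>k s. Y k s \<omega>) u at_top"
  shows "tendsto_locally_uniformly_in_prob M Y u"
  unfolding tendsto_locally_uniformly_in_prob_def
proof (intro allI impI)
  fix t \<epsilon> :: real assume t: "t > 0" and \<epsilon>: "\<epsilon> > 0"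
  interpret prob_space "completion M"
    using assms(1) by (rule prob_space.prob_space_completion)
  define A where "A k = {\<omega> \<in> space M. (SUP s\<in>{0..t}. ereal (norm (Y k s \<omega> - u s))) > ereal \<epsilon>}" for k
  define A' where "A' k = (if A k \<in> sets (completion M) then A k else {})" for k
  have A': "A' k \<in> sets (completion M)" for k
    by (simp add: A'_def)
  have meas: "measure (completion M) (A k) = integral\<^sup>L (completion M) (indicator (A' k))" for k
    using A'[of k] sets.sets_into_space[OF A'[of k]]
    by (auto simp: A'_def measure_notin_sets Int_absorb2 split: if_splits)
  \<comment> \<open>For almost every \<open>\<omega>\<close> the exceedance fails for all large
    \<open>k\<close>. Dominated convergence with bound \<open>1\<close> then gives convergence of
    the measures.\<close>
  have "AE \<omega> in completion M. ((\<lambda>k. indicat_real (A' k) \<omega>) \<longlongrightarrow> 0) at_top"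
    using AE_completion[OF AE[OF t]]
  proof eventually_elim
    case (elim \<omega>)
    have "\<forall>\<^sub>F k in at_top. \<forall>s\<in>{0..t}. dist (Y k s \<omega>) (u s) < \<epsilon>"
      using uniform_limitD[OF elim \<epsilon>] .
    then have "\<forall>\<^sub>F k in at_top. indicat_real (A' k) \<omega> = 0"
    proof eventually_elim
      case (elim k)
      then have "(SUP s\<in>{0..t}. ereal (norm (Y k s \<omega> - u s))) \<le> ereal \<epsilon>"
        by (intro SUP_least) (auto simp: dist_norm intro: less_imp_le)
      then show ?case
        by (auto simp: A'_def A_def indicator_def)
    qed
    then show ?case
      by (rule tendsto_eventually)
  qed
  then have "((\<lambda>k. integral\<^sup>L (completion M) (indicat_real (A' k)))
      \<longlongrightarrow> integral\<^sup>L (completion M) (\<lambda>_. 0)) at_top"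
    using A' by (intro integral_dominated_convergence_at_top[where w = "\<lambda>_. 1"])
      (auto intro!: always_eventually simp: indicator_def)
  then show "((\<lambda>k. measure (completion M)
      {\<omega> \<in> space M. (SUP s\<in>{0..t}. ereal (norm (Y k s \<omega> - u s))) > ereal \<epsilon>}) \<longlongrightarrow> 0) at_top"
    using meas by (simp add: A_def)
qed

text \<open>Scaling turns the constant \<open>R\<close> into \<open>R / sqrt k\<close>, which tends
  to \<open>0\<close> and does not involve \<open>s\<close>.\<close>

lemma uniform_limit_divide_sqrt:
  fixes Z :: "real \<Rightarrow> 'a \<Rightarrow> 'b::real_normed_vector"
  assumes R: "\<And>k s. k\<^sub>0 \<le> k \<Longrightarrow> s \<in> S \<Longrightarrow> norm (Z k s - sqrt k *\<^sub>R u s) \<le> R"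
  shows "uniform_limit S (\<lambda>k s. Z k s /\<^sub>R sqrt k) u at_top"
proof (rule uniform_limitI)
  fix e :: real assume e: "e > 0"
  have "((\<lambda>k. R / sqrt k) \<longlongrightarrow> 0) at_top"
    by (intro tendsto_divide_0[OF tendsto_const] filterlim_at_top_imp_at_infinity sqrt_at_top)
  then have "\<forall>\<^sub>F k in at_top. R / sqrt k < e"
    using e by (rule order_tendstoD)
  then show "\<forall>\<^sub>F k in at_top. \<forall>s\<in>S. dist (Z k s /\<^sub>R sqrt k) (u s) < e"
    \<comment> \<open>Positivity of \<open>k\<close> makes \<open>sqrt k\<close> invertible;
      \<open>k\<^sub>0\<close> may be negative here.\<close>
    using eventually_ge_at_top[of k\<^sub>0] eventually_gt_at_top[of 0]
  proof eventually_elim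
    case (elim k)
    have "dist (Z k s /\<^sub>R sqrt k) (u s) \<le> R / sqrt k" if "s \<in> S" for s
    proof -
      have "Z k s /\<^sub>R sqrt k - u s = (Z k s - sqrt k *\<^sub>R u s) /\<^sub>R sqrt k"
        using elim by (simp add: scaleR_diff_right)
      then show ?thesis
        using R[of k s] elim that by (simp add: dist_norm divide_inverse mult.commute)
    qed
    then show ?case
      using elim by fastforce
  qed
qed

theorem theorem2p4:
  fixes M :: "'w measure"
    and B :: "real \<Rightarrow> 'w \<Rightarrow> real ^ 'n::{finite,linorder}"
    and X :: "real \<Rightarrow> real \<Rightarrow> 'w \<Rightarrow> real ^ 'n::{finite,linorder}"
    and \<phi> :: "real \<Rightarrow> real ^ 'n::{finite,linorder} \<Rightarrow> real ^ 'n::{finite,linorder}"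
    and x y :: "real ^ 'n::{finite,linorder}"
    and k\<^sub>0 :: real
  assumes "brownian_motion M B"
    and "x \<in> interior weyl_chamber_A"
    and "H_trajectory (\<lambda>t. \<phi> t x) x"
    and "k\<^sub>0 \<ge> 1 / 2"
    and "\<And>k. k \<ge> k\<^sub>0 \<Longrightarrow> sqrt k *\<^sub>R x + y \<in> interior weyl_chamber_A"
    and "bessel_processes_A M B k\<^sub>0 (\<lambda>k. sqrt k *\<^sub>R x + y) X"
  shows "(\<forall>t>0. AE \<omega> in M.
            (SUP (s, k)\<in>{0..t} \<times> {k\<^sub>0..}. ereal (norm (X k s \<omega> - sqrt k *\<^sub>R \<phi> s x))) < \<infinity>) \<and>
         (AE \<omega> in M. \<forall>t>0.
            uniform_limit {0..t} (\<lambda>k s. X k s \<omega> /\<^sub>R sqrt k) (\<lambda>s. \<phi> s x) at_top) \<and>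
         tendsto_locally_uniformly_in_prob M (\<lambda>k s \<omega>. X k s \<omega> /\<^sub>R sqrt k) (\<lambda>s. \<phi> s x)"
proof -
  have "AE \<omega> in M. continuous_on {0..} (\<lambda>t. B t \<omega>)" and "prob_space M"
    using assms(1) by (auto simp: brownian_motion_def)
  have "AE \<omega> in M. \<forall>k\<ge>k\<^sub>0. bessel_path k (sqrt k *\<^sub>R x + y) (\<lambda>t. B t \<omega>) (\<lambda>t. X k t \<omega>)"
    using assms(6) by (simp add: bessel_processes_A_def)
  with \<open>AE \<omega> in M. continuous_on {0..} (\<lambda>t. B t \<omega>)\<close>
  \<comment> \<open>The quantifiers over \<open>t\<close> and \<open>k\<close> stand inside
    \<open>AE\<close>: continuity on \<open>{0..}\<close> and the path equations for all
    \<open>k\<close> each have one exceptional null set, so no uncountable union occurs.\<close>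
  have bound: "AE \<omega> in M. \<forall>t. \<exists>R. \<forall>k\<ge>k\<^sub>0. \<forall>s\<in>{0..t}. norm (X k s \<omega> - sqrt k *\<^sub>R \<phi> s x) \<le> R"
  proof eventually_elim
    case (elim \<omega>)
    show ?case
    proof
      fix t
      have "continuous_on {0..t} (\<lambda>t. B t \<omega>)"
        using elim(1) by (rule continuous_on_subset) auto
      then obtain R where "\<And>k \<xi> s. k\<^sub>0 \<le> k \<Longrightarrow> bessel_path k (sqrt k *\<^sub>R x + y) (\<lambda>t. B t \<omega>) \<xi>
          \<Longrightarrow> s \<in> {0..t} \<Longrightarrow> norm (\<xi> s - sqrt k *\<^sub>R \<phi> s x) \<le> R"
        using bessel_path_deviation_bounded[OF _ assms(3), of t "\<lambda>t. B t \<omega>" k\<^sub>0 y] assms(4)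
        by force
      with elim(2) show "\<exists>R. \<forall>k\<ge>k\<^sub>0. \<forall>s\<in>{0..t}. norm (X k s \<omega> - sqrt k *\<^sub>R \<phi> s x) \<le> R"
        by blast
    qed
  qed
  have "AE \<omega> in M.
      (SUP (s, k)\<in>{0..t} \<times> {k\<^sub>0..}. ereal (norm (X k s \<omega> - sqrt k *\<^sub>R \<phi> s x))) < \<infinity>" for t
    using bound
  proof eventually_elim
    case (elim \<omega>)
    then obtain R where "\<forall>k\<ge>k\<^sub>0. \<forall>s\<in>{0..t}. norm (X k s \<omega> - sqrt k *\<^sub>R \<phi> s x) \<le> R"
      by blast
    then have "(SUP (s, k)\<in>{0..t} \<times> {k\<^sub>0..}. ereal (norm (X k s \<omega> - sqrt k *\<^sub>R \<phi> s x))) \<le> ereal R"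
      by (intro SUP_least) auto
    then show ?case
      by (rule le_less_trans) simp
  qed
  moreover have unif: "AE \<omega> in M. \<forall>t>0.
      uniform_limit {0..t} (\<lambda>k s. X k s \<omega> /\<^sub>R sqrt k) (\<lambda>s. \<phi> s x) at_top"
    using bound
  proof eventually_elim
    case (elim \<omega>)
    show ?case
    proof (intro allI impI)
      fix t
      obtain R where "\<forall>k\<ge>k\<^sub>0. \<forall>s\<in>{0..t}. norm (X k s \<omega> - sqrt k *\<^sub>R \<phi> s x) \<le> R"
        using elim by blast
      then show "uniform_limit {0..t} (\<lambda>k s. X k s \<omega> /\<^sub>R sqrt k) (\<lambda>s. \<phi> s x) at_top"
        by (intro uniform_limit_divide_sqrt[where k\<^sub>0 = k\<^sub>0 and R = R]) auto
    qed
  qed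
  moreover have "tendsto_locally_uniformly_in_prob M (\<lambda>k s \<omega>. X k s \<omega> /\<^sub>R sqrt k) (\<lambda>s. \<phi> s x)"
    using \<open>prob_space M\<close>
  proof (rule AE_uniform_limit_imp_tendsto_locally_uniformly_in_prob)
    fix t :: real assume "0 < t"
    with unif show "AE \<omega> in M.
        uniform_limit {0..t} (\<lambda>k s. X k s \<omega> /\<^sub>R sqrt k) (\<lambda>s. \<phi> s x) at_top"
      by (auto elim: eventually_mono)
  qed
  ultimately show ?thesis
    by blast
qed

end
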